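(* Let $p\ge1$, $m=2p$, and $V=\{2s\}$ for some integer $1\le s\le p$. Then the sequence $H(D^{(2p,\{2s\})})$ can be partitioned into consecutive sections of the form \[H(D^{(2p,\{2s\})})=(\underbrace{1,\dots,1}_{s},\underbrace{a_{1,1},\dots,a_{1,p}}_{p},\underbrace{a_{2,1},\dots,a_{2,p}}_{p},\underbrace{a_{3,1},\dots,a_{3,p}}_{p},\dots)\] such that each section $(a_{j,1},\dots,a_{j,p})$ is an arithmetic progression with common difference $d_j$, where $a_{1,1}=0$, $d_1=-1$, and for $j\ge2$: $a_{j,1}=d_{j-1}$ and $d_j=d_{j-1}-a_{j-1,p}$.
   Context: For an integer $m\ge 2$ and $V\subseteq[m]=\{1,\dots,m\}$, let $(m,V)=\{k\in\mathbb{Z}^+ : k\equiv j \pmod m \text{ for some } j\in V\}$. A Dyck path of size $n$ is a lattice path from $(0,0)$ to $(2n,0)$ with steps $(1,1)$ and $(1,-1)$ never going below the $x$-axis; a peak is an up-step immediately followed by a down-step, and its height is the $y$-coordinate of the point between them. Let $d_n^{(m,V)}$ be the number of Dyck paths of size $n$ none of whose peaks has height in $(m,V)$, and $D^{(m,V)}(x)=\sum_{n\ge0}d_n^{(m,V)}x^n$. For a power series $F=\sum f_nx^n$ and $n\ge1$, $H_n(F)=\det(f_{i+j})_{0\le i,j\le n-1}$ and $H(F)=(H_1(F),H_2(F),\dots)$. *)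

theory Defs
  imports "Jordan_Normal_Form.Determinant" "HOL-Computational_Algebra.Formal_Power_Series"
    "HOL-Number_Theory.Cong"
begin

definition residue_heights :: "nat \<Rightarrow> nat set \<Rightarrow> nat set" where
  "residue_heights m V = {k. 0 < k \<and> (\<exists>j\<in>V. [k = j] (mod m))}"

text \<open>A lattice path starting at the origin is encoded by its list of steps;
  \<open>Up\<close> is the step (1,1) and \<open>Down\<close> is the step (1,-1).\<close>

datatype step = Up | Down

fun rise :: "step \<Rightarrow> int" where
  "rise Up = 1"
| "rise Down = -1"

text \<open>The y-coordinate of the path \<open>w\<close> at abscissa \<open>i\<close>, for \<open>i \<le> length w\<close>.\<close>

definition path_height :: "step list \<Rightarrow> nat \<Rightarrow> int" where
  "path_height w i = sum_list (map rise (take i w))"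

definition dyck_path :: "nat \<Rightarrow> step list \<Rightarrow> bool" where
  "dyck_path n w \<longleftrightarrow> length w = 2 * n \<and> path_height w (2 * n) = 0
     \<and> (\<forall>i \<le> 2 * n. 0 \<le> path_height w i)"

text \<open>\<open>i\<close> is the abscissa of the point between the two steps, which are
  entries \<open>i - 1\<close> and \<open>i\<close> of the list.\<close>

definition peak_at :: "step list \<Rightarrow> nat \<Rightarrow> bool" where
  "peak_at w i \<longleftrightarrow> 0 < i \<and> i < length w \<and> w ! (i - 1) = Up \<and> w ! i = Down"

definition dyck_count :: "nat \<Rightarrow> nat set \<Rightarrow> nat \<Rightarrow> nat" where
  "dyck_count m V n = card {w. dyck_path n w
     \<and> (\<forall>i. peak_at w i \<longrightarrow> path_height w i \<notin> int ` residue_heights m V)}"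

definition dyck_gf :: "nat \<Rightarrow> nat set \<Rightarrow> int fps" where
  "dyck_gf m V = Abs_fps (\<lambda>n. int (dyck_count m V n))"

definition hankel :: "nat \<Rightarrow> 'a::comm_ring_1 fps \<Rightarrow> 'a" where
  "hankel n F = det (mat n n (\<lambda>(i, j). fps_nth F (i + j)))"

end

theory Submission
  imports Defs
begin

text \<open>
  Let \<open>h n\<close> be the Hankel determinant of order \<open>n\<close>.  If all forbidden peak heights are even, then the
  numbers \<open>c n k\<close> of admissible path prefixes of length \<open>2 n + 1\<close> ending at height \<open>2 k + 1\<close> obey a
  symmetric tridiagonal recurrence, and the coefficients of the generating function are
  \<open>1, c 0 0, c 1 0, c 2 0, \<dots>\<close>.  Hence the Hankel matrix factors as \<open>M T M\<^sup>T\<close> with \<open>M\<close> unitriangular and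
  \<open>T\<close> tridiagonal, and expanding \<open>det T\<close> gives \<open>h (n + 2) = 2 h (n + 1) - h n\<close>, except that the factor
  2 becomes 1 when \<open>2 n + 2\<close> is a forbidden height.  So \<open>h\<close> has constant differences
  between two consecutive such indices.
\<close>

section \<open>Admissible prefixes\<close>

text \<open>No condition on the endpoint, so that prefixes can be extended step by step.\<close>

definition admissible :: "int set \<Rightarrow> step list \<Rightarrow> bool" where
  "admissible S w \<longleftrightarrow> (\<forall>i \<le> length w. 0 \<le> path_height w i)
     \<and> (\<forall>i. peak_at w i \<longrightarrow> path_height w i \<notin> S)"

definition prefixes_to :: "int set \<Rightarrow> nat \<Rightarrow> int \<Rightarrow> step list set" where
  "prefixes_to S l h = {w. length w = l \<and> sum_list (map rise w) = h \<and> admissible S w}"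

definition prefix_count :: "int set \<Rightarrow> nat \<Rightarrow> int \<Rightarrow> int" where
  "prefix_count S l h = int (card (prefixes_to S l h))"

lemma path_height_length: "path_height w (length w) = sum_list (map rise w)"
  by (simp add: path_height_def)

lemma path_height_snoc: "i \<le> length w \<Longrightarrow> path_height (w @ [x]) i = path_height w i"
  by (simp add: path_height_def)

lemma peak_at_snoc:
  "peak_at (w @ [x]) i \<longleftrightarrow> peak_at w i \<or> i = length w \<and> w \<noteq> [] \<and> last w = Up \<and> x = Down"
  by (cases "w = []")
    (auto simp: peak_at_def nth_append last_conv_nth less_Suc_eq)

text \<open>Appending a step adds one new height and at most one new peak, which sits at the old
  endpoint.\<close>

lemma admissible_snoc:
  "admissible S (w @ [x]) \<longleftrightarrow> admissible S w \<and> 0 \<le> sum_list (map rise w) + rise x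
     \<and> \<not> (w \<noteq> [] \<and> last w = Up \<and> x = Down \<and> sum_list (map rise w) \<in> S)"
proof -
  have "(\<forall>i \<le> length (w @ [x]). 0 \<le> path_height (w @ [x]) i) \<longleftrightarrow>
        (\<forall>i \<le> length w. 0 \<le> path_height w i) \<and> 0 \<le> sum_list (map rise w) + rise x"
    using path_height_length[of "w @ [x]"]
    by (auto simp: le_Suc_eq path_height_snoc)
  moreover have "(\<forall>i. peak_at (w @ [x]) i \<longrightarrow> path_height (w @ [x]) i \<notin> S) \<longleftrightarrow>
     (\<forall>i. peak_at w i \<longrightarrow> path_height w i \<notin> S) \<and>
     \<not> (w \<noteq> [] \<and> last w = Up \<and> x = Down \<and> sum_list (map rise w) \<in> S)"
  proof -
    have "peak_at w i \<Longrightarrow> i \<le> length w" for i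
      by (simp add: peak_at_def)
    then show ?thesis
      by (metis path_height_length path_height_snoc peak_at_snoc order_refl)
  qed
  ultimately show ?thesis
    unfolding admissible_def by blast
qed

lemma finite_prefixes_to [simp]: "finite (prefixes_to S l h)"
proof (rule finite_subset)
  have "UNIV = {Up, Down}"
    using step.exhaust by blast
  then have "finite (UNIV :: step set)"
    by (metis finite.emptyI finite_insert)
  then show "finite {w :: step list. set w \<subseteq> UNIV \<and> length w = l}"
    by (rule finite_lists_length_eq)
qed (auto simp: prefixes_to_def)

lemma prefixes_to_neg: "h < 0 \<Longrightarrow> prefixes_to S l h = {}"
  unfolding prefixes_to_def admissible_def
  by (metis (mono_tags, lifting) Collect_empty_eq leD order_refl path_height_length)

lemma prefixes_to_0: "prefixes_to S 0 h = (if h = 0 then {[]} else {})"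
  by (auto simp: prefixes_to_def admissible_def path_height_def peak_at_def)

lemma prefix_count_0: "prefix_count S 0 h = (if h = 0 then 1 else 0)"
  by (simp add: prefix_count_def prefixes_to_0)

lemma prefix_count_neg: "h < 0 \<Longrightarrow> prefix_count S l h = 0"
  by (simp add: prefix_count_def prefixes_to_neg)

lemma card_snoc: "card ((\<lambda>w. w @ [x]) ` A) = card A"
  by (rule card_image) (simp add: inj_on_def)

lemma snoc_mem_prefixes_to:
  "w @ [x] \<in> prefixes_to S (Suc l) h \<longleftrightarrow> w \<in> prefixes_to S l (h - rise x) \<and> 0 \<le> h
     \<and> \<not> (w \<noteq> [] \<and> last w = Up \<and> x = Down \<and> h + 1 \<in> S)"
  by (cases x) (auto simp: prefixes_to_def admissible_snoc)

text \<open>Base case for the recurrence below, which goes back two steps.\<close>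

lemma prefix_count_1: "prefix_count S 1 h = (if h = 1 then 1 else 0)"
proof -
  have "prefixes_to S (Suc 0) h = (if h = 1 then {[Up]} else {})"
  proof (rule Set.set_eqI)
    fix w :: "step list"
    show "w \<in> prefixes_to S (Suc 0) h \<longleftrightarrow> w \<in> (if h = 1 then {[Up]} else {})"
    proof (cases w rule: rev_cases)
      case Nil
      then show ?thesis by (simp add: prefixes_to_def)
    next
      case (snoc v x)
      then show ?thesis
        by (cases x) (auto simp: snoc_mem_prefixes_to prefixes_to_0)
    qed
  qed
  then show ?thesis by (simp add: prefix_count_def)
qed

text \<open>Removing the last step, every pair of a shorter admissible prefix and a last step is
  allowed, except that \<open>v @ [Up, Down]\<close> must not have its peak at a height in \<open>S\<close>.\<close>

lemma prefix_count_Suc_Suc: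
  assumes "0 \<le> h"
  shows "prefix_count S (Suc (Suc l)) h =
     prefix_count S (Suc l) (h - 1) + prefix_count S (Suc l) (h + 1)
       - (if h + 1 \<in> S then prefix_count S l h else 0)"
proof -
  let ?A = "prefixes_to S (Suc (Suc l)) h"
  let ?U = "(\<lambda>w. w @ [Up]) ` prefixes_to S (Suc l) (h - 1)"
  let ?D = "(\<lambda>w. w @ [Down]) ` prefixes_to S (Suc l) (h + 1)"
  let ?X = "if h + 1 \<in> S then (\<lambda>w. w @ [Down]) ` (\<lambda>w. w @ [Up]) ` prefixes_to S l h else {}"
  have peak: "(\<lambda>w. w @ [Up]) ` prefixes_to S l h =
      {v \<in> prefixes_to S (Suc l) (h + 1). v \<noteq> [] \<and> last v = Up}"
  proof (rule Set.set_eqI)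
    fix v :: "step list"
    show "v \<in> (\<lambda>w. w @ [Up]) ` prefixes_to S l h \<longleftrightarrow>
        v \<in> {v \<in> prefixes_to S (Suc l) (h + 1). v \<noteq> [] \<and> last v = Up}"
      using assms by (cases v rule: rev_cases) (auto simp: snoc_mem_prefixes_to)
  qed
  \<comment> \<open>\<open>?X\<close> holds the extensions lost to a forbidden final peak. Both
    unions are disjoint, so cardinalities add up without subtraction on \<open>nat\<close>.\<close>
  have "?A \<union> ?X = ?U \<union> ?D"
  proof (rule Set.set_eqI)
    fix w :: "step list"
    show "w \<in> ?A \<union> ?X \<longleftrightarrow> w \<in> ?U \<union> ?D"
    proof (cases w rule: rev_cases)
      case Nil
      then show ?thesis by (auto simp: prefixes_to_def)
    next
      case (snoc v x)
      then show ?thesis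
        unfolding peak using assms by (cases x) (auto simp: snoc_mem_prefixes_to)
    qed
  qed
  moreover have "w \<notin> ?A" if "w \<in> ?X" for w
  proof -
    from that obtain v where "w = v @ [Down]" "v \<noteq> []" "last v = Up" "h + 1 \<in> S"
      unfolding peak by (auto split: if_splits)
    then show ?thesis
      by (simp add: snoc_mem_prefixes_to)
  qed
  then have "?A \<inter> ?X = {}"
    by blast
  moreover have "?U \<inter> ?D = {}"
    by auto
  ultimately have "card ?A + card ?X = card ?U + card ?D"
    using card_Un_disjoint[of ?A ?X] card_Un_disjoint[of ?U ?D] by simp
  then show ?thesis
    by (cases "h + 1 \<in> S") (simp_all add: prefix_count_def card_snoc)
qed

lemma dyck_count_eq_prefix_count:
  "int (dyck_count m V n) = prefix_count (int ` residue_heights m V) (2 * n) 0"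
proof -
  have "dyck_path n w \<longleftrightarrow> length w = 2 * n \<and> sum_list (map rise w) = 0
      \<and> (\<forall>i \<le> length w. 0 \<le> path_height w i)" for w
    unfolding dyck_path_def using path_height_length[of w] by auto
  then show ?thesis
    unfolding dyck_count_def prefix_count_def prefixes_to_def admissible_def
    by (simp add: conj_assoc)
qed

section \<open>Tridiagonal recurrences and Hankel determinants\<close>

locale tridiagonal =
  fixes a :: "nat \<Rightarrow> 'a :: comm_ring_1" and c :: "nat \<Rightarrow> nat \<Rightarrow> 'a"
  assumes c_0: "c 0 k = (if k = 0 then 1 else 0)"
    and c_Suc_0: "c (Suc n) 0 = a 0 * c n 0 + c n 1"
    and c_Suc_Suc: "c (Suc n) (Suc k) = c n k + a (Suc k) * c n (Suc k) + c n (Suc (Suc k))"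
begin

section \<open>Inner products of the rows of \<open>c\<close>\<close>

lemma c_eq_0: "n < k \<Longrightarrow> c n k = 0"
proof (induction n arbitrary: k)
  case (Suc n)
  then show ?case by (cases k) (auto simp: c_Suc_Suc)
qed (simp add: c_0)

lemma c_diag: "c n n = 1"
  by (induction n) (auto simp: c_0 c_Suc_Suc c_eq_0)

text \<open>Expanding the row \<open>Suc i\<close> by the recurrence gives an expression symmetric
  in \<open>i\<close> and \<open>j\<close>. The bound on \<open>i\<close> removes the boundary term
  \<open>c i (Suc N)\<close>.\<close>

lemma sum_c_Suc:
  assumes "i \<le> N"
  shows "(\<Sum>k<Suc N. c (Suc i) k * c j k) =
     (\<Sum>k<Suc N. a k * c i k * c j k) + (\<Sum>k<N. c i k * c j (Suc k)) + (\<Sum>k<N. c i (Suc k) * c j k)"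
proof -
  have "(\<Sum>k<Suc N. c (Suc i) k * c j k) =
      (a 0 * c i 0 + c i 1) * c j 0
      + (\<Sum>k<N. (c i k + a (Suc k) * c i (Suc k) + c i (Suc (Suc k))) * c j (Suc k))"
    by (simp add: sum.lessThan_Suc_shift c_Suc_0 c_Suc_Suc del: sum.lessThan_Suc)
  also have "\<dots> = (a 0 * c i 0 * c j 0 + (\<Sum>k<N. a (Suc k) * c i (Suc k) * c j (Suc k)))
      + (\<Sum>k<N. c i k * c j (Suc k))
      + (c i 1 * c j 0 + (\<Sum>k<N. c i (Suc (Suc k)) * c j (Suc k)))"
    by (simp add: algebra_simps sum.distrib)
  also have "a 0 * c i 0 * c j 0 + (\<Sum>k<N. a (Suc k) * c i (Suc k) * c j (Suc k)) =
      (\<Sum>k<Suc N. a k * c i k * c j k)"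
    by (simp add: sum.lessThan_Suc_shift del: sum.lessThan_Suc)
  also have "c i 1 * c j 0 + (\<Sum>k<N. c i (Suc (Suc k)) * c j (Suc k)) =
      (\<Sum>k<Suc N. c i (Suc k) * c j k)"
    by (simp add: sum.lessThan_Suc_shift del: sum.lessThan_Suc)
  also have "\<dots> = (\<Sum>k<N. c i (Suc k) * c j k)"
    using assms by (simp add: c_eq_0)
  finally show ?thesis .
qed

lemma sum_c_Suc_commute:
  assumes "i \<le> N" "j \<le> N"
  shows "(\<Sum>k<Suc N. c (Suc i) k * c j k) = (\<Sum>k<Suc N. c i k * c (Suc j) k)"
proof -
  have "(\<Sum>k<Suc N. c i k * c (Suc j) k) = (\<Sum>k<Suc N. c (Suc j) k * c i k)"
    by (simp add: mult.commute)
  then show ?thesis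
    using sum_c_Suc[OF assms(1), of j] sum_c_Suc[OF assms(2), of i]
    by (simp add: algebra_simps del: sum.lessThan_Suc)
qed

text \<open>Symmetry moves one unit at a time from \<open>i\<close> to \<open>j\<close>, keeping
  \<open>i + j\<close> fixed, until row 0, a unit vector, picks out the entry in column 0.\<close>

lemma sum_c_mult:
  assumes "i + j \<le> N"
  shows "(\<Sum>k<Suc N. c i k * c j k) = c (i + j) 0"
  using assms
proof (induction i arbitrary: j)
  case 0
  then show ?case
    by (simp add: sum.lessThan_Suc_shift c_0 del: sum.lessThan_Suc)
next
  case (Suc i)
  then show ?case
    using sum_c_Suc_commute[of i N j] Suc.IH[of "Suc j"] by simp
qed

text \<open>The coefficients of \<open>1 + x G\<close>, where \<open>G\<close> has the coefficients \<open>c n 0\<close>, are the moments in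
  the basis given by the rows of \<open>M\<close>, whose Gram matrix is \<open>T\<close>.\<close>

definition M :: "nat \<Rightarrow> nat \<Rightarrow> 'a" where
  "M i k = (case i of 0 \<Rightarrow> if k = 0 then 1 else 0
    | Suc i' \<Rightarrow> (case k of 0 \<Rightarrow> 0 | Suc k' \<Rightarrow> c i' k'))"

definition T :: "nat \<Rightarrow> nat \<Rightarrow> 'a" where
  "T k l = (if k = l then (case k of 0 \<Rightarrow> 1 | Suc k' \<Rightarrow> a k')
     else if k = Suc l \<or> l = Suc k then 1 else 0)"

lemma sum_c_mult':
  assumes "j < N"
  shows "(\<Sum>k<N. c i k * c j k) = c (i + j) 0"
proof -
  have "(\<Sum>k<N. c i k * c j k) = (\<Sum>k<Suc (i + j + N). c i k * c j k)"
    using assms by (intro sum.mono_neutral_left) (auto simp: c_eq_0)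
  then show ?thesis
    by (simp add: sum_c_mult del: sum.lessThan_Suc)
qed

lemma sum_T_0:
  "0 < n \<Longrightarrow> (\<Sum>k<n. f k * T k 0) = f 0 + (if 1 < n then f 1 else 0)"
proof -
  assume "0 < n"
  have "f k * T k 0 = (if k = 0 then f k else 0) + (if k = 1 then f k else 0)" for k
    by (auto simp: T_def)
  then show ?thesis
    using \<open>0 < n\<close> by (simp add: sum.distrib)
qed

lemma sum_T_Suc:
  assumes "Suc l < n"
  shows "(\<Sum>k<n. f k * T k (Suc l)) =
     f l + f (Suc l) * a l + (if Suc (Suc l) < n then f (Suc (Suc l)) else 0)"
proof -
  have "f k * T k (Suc l) = (if k = l then f k else 0) + (if k = Suc l then f k * a l else 0)
      + (if k = Suc (Suc l) then f k else 0)" for k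
    by (auto simp: T_def)
  then show ?thesis
    using assms by (simp add: sum.distrib)
qed

text \<open>For \<open>i\<close> and \<open>l\<close> positive, multiplying by \<open>T\<close> is
  one application of the recurrence, so row \<open>i - 1\<close> of \<open>c\<close> becomes row
  \<open>i\<close>.\<close>

lemma sum_M_T:
  assumes "i < n" "l < n"
  shows "(\<Sum>k<n. M i k * T k l) =
    (if i = 0 then (if l \<le> 1 then 1 else 0) else if l = 0 then c (i - 1) 0 else c i (l - 1))"
proof (cases l)
  case 0
  then show ?thesis
    using assms by (auto simp: sum_T_0 M_def split: nat.split)
next
  case (Suc l')
  show ?thesis
  proof (cases i)
    case 0
    then show ?thesis
      using assms Suc by (auto simp: sum_T_Suc M_def split: nat.split)
  next
    case (Suc i')
    \<comment> \<open>In the last column the truncation cuts off a term, which is zero by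
      triangularity.\<close>
    have "c i' (Suc l') = 0" if "\<not> Suc (Suc l') < n"
      using that assms Suc by (intro c_eq_0) simp
    then show ?thesis
      using assms Suc \<open>l = Suc l'\<close>
      by (cases l') (auto simp: sum_T_Suc M_def c_Suc_0 c_Suc_Suc algebra_simps)
  qed
qed

text \<open>For \<open>i\<close> and \<open>j\<close> positive this is the inner product of the rows
  \<open>i\<close> and \<open>j - 1\<close> of \<open>c\<close>; the remaining cases involve unit
  vectors.\<close>

lemma sum_M_T_M:
  assumes "i < n" "j < n"
  shows "(\<Sum>l<n. (\<Sum>k<n. M i k * T k l) * M j l) = (if i + j = 0 then 1 else c (i + j - 1) 0)"
proof -
  have *: "(\<Sum>l<n. (\<Sum>k<n. M i k * T k l) * M j l) =
     (\<Sum>l<n. (if i = 0 then (if l \<le> 1 then 1 else 0)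
        else if l = 0 then c (i - 1) 0 else c i (l - 1)) * M j l)"
    using assms(1) by (intro sum.cong) (auto simp: sum_M_T)
  obtain n' where n: "n = Suc n'"
    using assms by (cases n) auto
  show ?thesis
  proof (cases j)
    case 0
    then show ?thesis
      unfolding * unfolding n
      by (auto simp: sum.lessThan_Suc_shift M_def simp del: sum.lessThan_Suc)
  next
    case (Suc j')
    have j': "j' < n'"
      using assms Suc n by simp
    show ?thesis
    proof (cases "i = 0")
      case True
      have "(\<Sum>l<n'. (if Suc l \<le> 1 then 1 else 0) * c j' l) = (\<Sum>l<n'. if l = 0 then c j' l else 0)"
        by (intro sum.cong) auto
      then show ?thesis
        unfolding * unfolding n using True Suc j'
        by (simp add: sum.lessThan_Suc_shift M_def del: sum.lessThan_Suc)
    next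
      case False
      then show ?thesis
        unfolding * unfolding n using Suc sum_c_mult'[OF j', of i]
        by (simp add: sum.lessThan_Suc_shift M_def del: sum.lessThan_Suc)
    qed
  qed
qed

section \<open>Determinants of the factors\<close>

lemma det_M: "det (mat n n (\<lambda>(i, k). M i k)) = 1"
proof -
  let ?A = "mat n n (\<lambda>(i, k). M i k)"
  have "M i k = 0" if "i < k" for i k
    using that by (auto simp: M_def c_eq_0 split: nat.split)
  moreover have "M i i = 1" for i
    by (auto simp: M_def c_diag split: nat.split)
  moreover from this have "diag_mat ?A = replicate n 1"
    by (intro nth_equalityI) (simp_all add: diag_mat_def)
  ultimately show ?thesis
    using det_lower_triangular[of n ?A] by simp
qed

lemma hankel_eq_det_T:
  assumes "fps_nth F 0 = 1" and "\<And>n. fps_nth F (Suc n) = c n 0"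
  shows "hankel n F = det (mat n n (\<lambda>(k, l). T k l))"
proof -
  let ?M = "mat n n (\<lambda>(i, k). M i k)" and ?T = "mat n n (\<lambda>(k, l). T k l)"
  have F: "fps_nth F (i + j) = (if i + j = 0 then 1 else c (i + j - 1) 0)" for i j
    using assms by (cases "i + j") simp_all
  have "mat n n (\<lambda>(i, j). fps_nth F (i + j)) = ?M * ?T * transpose_mat ?M"
    by (rule eq_matI)
      (simp_all add: F scalar_prod_def atLeast0LessThan sum_M_T_M)
  moreover have M: "?M \<in> carrier_mat n n" and T: "?T \<in> carrier_mat n n"
    by simp_all
  ultimately have "hankel n F = det ?M * det ?T * det (transpose_mat ?M)"
    unfolding hankel_def
    by (simp only: det_mult[OF mult_carrier_mat[OF M T] transpose_carrier_mat[THEN iffD2, OF M]] det_mult[OF M T])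
  then show ?thesis
    by (simp add: det_transpose[of _ n] det_M)
qed

text \<open>Laplace expansion along the last row, which has only the entries 1 and
  \<open>a n\<close>; the index of \<open>a\<close> lags by one because row 0 of \<open>T\<close>
  has diagonal entry 1.\<close>

lemma det_T_Suc_Suc:
  "det (mat (Suc (Suc n)) (Suc (Suc n)) (\<lambda>(k, l). T k l)) =
     a n * det (mat (Suc n) (Suc n) (\<lambda>(k, l). T k l)) - det (mat n n (\<lambda>(k, l). T k l))"
proof -
  define A where "A m = mat m m (\<lambda>(k, l). T k l)" for m
  have A: "A m \<in> carrier_mat m m" for m
    by (simp add: A_def)
  define B where "B = mat_delete (A (Suc (Suc n))) (Suc n) n"
  have B: "B \<in> carrier_mat (Suc n) (Suc n)"
    by (simp add: B_def A_def mat_delete_def)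
  \<comment> \<open>The last column of \<open>B\<close> comes from column \<open>Suc n\<close> of
    \<open>T\<close>; its only nonzero entry is the 1 in row \<open>n\<close>.\<close>
  have "det B = (\<Sum>i<Suc n. B $$ (i, n) * cofactor B i n)"
    by (rule laplace_expansion_column[OF B]) simp
  also have "\<dots> = cofactor B n n"
    by (simp add: B_def A_def mat_delete_def T_def)
  also have "mat_delete B n n = A n"
    by (rule eq_matI) (auto simp: B_def A_def mat_delete_def)
  then have "cofactor B n n = det (A n)"
    by (simp add: cofactor_def flip: mult_2)
  finally have det_B: "det B = det (A n)" .
  have "det (A (Suc (Suc n))) =
      (\<Sum>j<Suc (Suc n). A (Suc (Suc n)) $$ (Suc n, j) * cofactor (A (Suc (Suc n))) (Suc n) j)"
    by (rule laplace_expansion_row[OF A]) simp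
  also have "\<dots> = cofactor (A (Suc (Suc n))) (Suc n) n + a n * cofactor (A (Suc (Suc n))) (Suc n) (Suc n)"
    by (simp add: A_def T_def)
  also have "cofactor (A (Suc (Suc n))) (Suc n) n = - det (A n)"
    by (simp add: cofactor_def det_B flip: B_def mult_2)
  also have "mat_delete (A (Suc (Suc n))) (Suc n) (Suc n) = A (Suc n)"
    by (rule eq_matI) (auto simp: A_def mat_delete_def)
  then have "cofactor (A (Suc (Suc n))) (Suc n) (Suc n) = det (A (Suc n))"
    by (simp add: cofactor_def flip: mult_2)
  finally show ?thesis
    by (simp add: A_def)
qed

end

lemma hankel_0: "hankel 0 F = 1"
  by (simp add: hankel_def)

lemma hankel_1: "hankel 1 F = fps_nth F 0"
  by (simp add: hankel_def det_single)

section \<open>Forbidden peaks at even heights\<close>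

text \<open>Two steps lead between odd heights. Staying at \<open>2 * k + 1\<close> is possible by a
  valley or by a peak at \<open>2 * k + 2\<close>, hence the diagonal weight 2, or 1 if that peak is
  forbidden.\<close>

lemma tridiagonal_prefix_count:
  assumes "\<And>h. h \<in> S \<Longrightarrow> even h"
  shows "tridiagonal (\<lambda>k. 2 - (if 2 * int k + 2 \<in> S then 1 else 0))
     (\<lambda>n k. prefix_count S (Suc (2 * n)) (2 * int k + 1))"
proof -
  let ?N = "prefix_count S"
  have odd: "2 * k + 1 \<notin> S" for k
    using assms[of "2 * k + 1"] by auto
  \<comment> \<open>A peak closed by a step down to an even height is at an odd height, so nothing
    is subtracted.\<close>
  have even_step: "?N (Suc (Suc l)) (2 * k) = ?N (Suc l) (2 * k - 1) + ?N (Suc l) (2 * k + 1)"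
    if "0 \<le> k" for k l
    using that odd by (simp add: prefix_count_Suc_Suc)
  have step: "?N (Suc (2 * Suc n)) (2 * k + 1) =
      ?N (Suc (2 * n)) (2 * k - 1) + (2 - (if 2 * k + 2 \<in> S then 1 else 0)) * ?N (Suc (2 * n)) (2 * k + 1)
        + ?N (Suc (2 * n)) (2 * k + 3)" if "0 \<le> k" for n k
    using that prefix_count_Suc_Suc[of "2 * k + 1" S "Suc (2 * n)"]
      even_step[of k "2 * n"] even_step[of "k + 1" "2 * n"]
    by (cases "2 * k + 2 \<in> S") (simp_all add: algebra_simps)
  show ?thesis
  proof
    fix k
    show "?N (Suc (2 * 0)) (2 * int k + 1) = (if k = 0 then 1 else 0)"
      using prefix_count_1[of S "2 * int k + 1"] by simp
  next
    fix n
    show "?N (Suc (2 * Suc n)) (2 * int 0 + 1) =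
        (2 - (if 2 * int 0 + 2 \<in> S then 1 else 0)) * ?N (Suc (2 * n)) (2 * int 0 + 1)
          + ?N (Suc (2 * n)) (2 * int 1 + 1)"
      using step[of 0 n] by (simp add: prefix_count_neg)
  next
    fix n k
    show "?N (Suc (2 * Suc n)) (2 * int (Suc k) + 1) = ?N (Suc (2 * n)) (2 * int k + 1)
        + (2 - (if 2 * int (Suc k) + 2 \<in> S then 1 else 0)) * ?N (Suc (2 * n)) (2 * int (Suc k) + 1)
        + ?N (Suc (2 * n)) (2 * int (Suc (Suc k)) + 1)"
      using step[of "int (Suc k)" n] by (simp add: algebra_simps)
  qed
qed

lemma hankel_dyck_gf_Suc_Suc:
  assumes "\<And>h. h \<in> residue_heights m V \<Longrightarrow> even h"
  shows "hankel (Suc (Suc n)) (dyck_gf m V) =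
     (2 - (if 2 * n + 2 \<in> residue_heights m V then 1 else 0)) * hankel (Suc n) (dyck_gf m V)
       - hankel n (dyck_gf m V)"
proof -
  let ?S = "int ` residue_heights m V"
  have S: "even h" if "h \<in> ?S" for h
    using that assms by auto
  interpret tridiagonal "\<lambda>k. 2 - (if 2 * int k + 2 \<in> ?S then 1 else 0)"
      "\<lambda>n k. prefix_count ?S (Suc (2 * n)) (2 * int k + 1)"
    by (rule tridiagonal_prefix_count[OF S])
  \<comment> \<open>Closing a path from height 1 is thus always allowed, so the coefficient at
    \<open>Suc n\<close> is the prefix count at height 1.\<close>
  have "1 \<notin> ?S"
    using S[of 1] by auto
  then have F: "hankel n (dyck_gf m V) = det (mat n n (\<lambda>(k, l). T k l))" for n
    by (intro hankel_eq_det_T)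
      (simp_all add: dyck_gf_def dyck_count_eq_prefix_count prefix_count_0 prefix_count_Suc_Suc
        prefix_count_neg)
  have "2 * int n + 2 = int (2 * n + 2)"
    by simp
  then have "2 * int n + 2 \<in> ?S \<longleftrightarrow> 2 * n + 2 \<in> residue_heights m V"
    by (simp only: image_iff of_nat_eq_iff) blast
  then show ?thesis
    by (simp only: F det_T_Suc_Suc)
qed

text \<open>Halving turns the congruence into one modulo \<open>p\<close>. Since \<open>s\<close> is
  the least positive member of its class, \<open>r\<close> can be a natural number.\<close>

lemma residue_heights_double:
  assumes "1 \<le> s" "s \<le> p"
  shows "2 * n \<in> residue_heights (2 * p) {2 * s} \<longleftrightarrow> (\<exists>r. n = s + r * p)"
proof
  assume "2 * n \<in> residue_heights (2 * p) {2 * s}"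
  then have n: "0 < n" "n mod p = s mod p"
    by (auto simp: residue_heights_def cong_def mod_mult_mult1)
  have "s \<le> n"
  proof (rule ccontr)
    assume "\<not> s \<le> n"
    then have "n mod p = n"
      using assms by simp
    then show False
      \<comment> \<open>For \<open>s = p\<close> the residue is 0, against \<open>0 < n\<close>;
        otherwise it is \<open>s\<close>, against \<open>n < s\<close>.\<close>
      using n assms \<open>\<not> s \<le> n\<close> by (cases "s = p") auto
  qed
  then have "p dvd n - s"
    using n by (metis mod_eq_dvd_iff_nat)
  then obtain r where "n - s = p * r" ..
  then show "\<exists>r. n = s + r * p"
    using \<open>s \<le> n\<close> by (intro exI[of _ r]) (simp add: mult.commute)
next
  assume "\<exists>r. n = s + r * p"
  then show "2 * n \<in> residue_heights (2 * p) {2 * s}"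
    using assms by (auto simp: residue_heights_def cong_def mod_mult_mult1)
qed

lemma even_residue_heights: "h \<in> residue_heights (2 * p) {2 * s} \<Longrightarrow> even h"
  by (auto simp: residue_heights_def cong_def) (metis dvd_mod_iff dvd_triv_left)

theorem theorem3p1:
  fixes p m s :: nat and V :: "nat set"
  assumes "p \<ge> 1" and "m = 2 * p" and "1 \<le> s" and "s \<le> p" and "V = {2 * s}"
  shows "\<exists>(a :: nat \<Rightarrow> nat \<Rightarrow> int) (d :: nat \<Rightarrow> int).
      (\<forall>n\<in>{1..s}. hankel n (dyck_gf m V) = 1)
    \<and> (\<forall>j\<ge>1. \<forall>i\<in>{1..p}. hankel (s + (j - 1) * p + i) (dyck_gf m V) = a j i)
    \<and> (\<forall>j\<ge>1. \<forall>i\<in>{1..<p}. a j (i + 1) - a j i = d j)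
    \<and> a 1 1 = 0 \<and> d 1 = -1
    \<and> (\<forall>j\<ge>2. a j 1 = d (j - 1) \<and> d j = d (j - 1) - a (j - 1) p)"
proof -
  define h where "h n = hankel n (dyck_gf m V)" for n
  have h_step: "h (Suc (Suc n)) = (2 - (if \<exists>r. Suc n = s + r * p then 1 else 0)) * h (Suc n) - h n" for n
    using hankel_dyck_gf_Suc_Suc[of m V n] residue_heights_double[of s p "Suc n"]
      even_residue_heights[of _ p s] assms
    by (simp add: h_def)
  have h_0: "h 0 = 1"
    by (simp add: h_def hankel_0)
  have h_1: "h 1 = 1"
  proof -
    have "prefix_count S 0 0 = 1" for S
      by (simp add: prefix_count_0)
    then show ?thesis
      by (simp add: h_def hankel_1[unfolded One_nat_def] dyck_gf_def dyck_count_eq_prefix_count)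
  qed
  \<comment> \<open>No index below \<open>s\<close> is special, so the initial difference 0
    persists.\<close>
  have h_init: "n < s \<Longrightarrow> h n = 1 \<and> h (Suc n) = 1" for n
  proof (induction n)
    case 0
    then show ?case using h_0 h_1 by simp
  next
    case (Suc n)
    then have "\<not> (\<exists>r. Suc n = s + r * p)" by auto
    then show ?case using Suc h_step[of n] by simp
  qed
  \<comment> \<open>At index \<open>s + j * p\<close> the factor drops from 2 to 1.\<close>
  have h_special: "h (s + j * p + 1) = h (s + j * p) - h (s + j * p - 1)" for j
    using h_step[of "s + j * p - 1"] assms by auto
  \<comment> \<open>Between special indices the factor is 2, so the difference of successive terms
    is preserved.\<close>
  have h_regular: "h (s + j * p + i + 1) - h (s + j * p + i) = h (s + j * p + 1) - h (s + j * p)"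
    if "i < p" for i j
    using that
  proof (induction i)
    case (Suc i)
    have "Suc (s + j * p + i) \<noteq> s + r * p" for r
    proof
      assume "Suc (s + j * p + i) = s + r * p"
      then have "(j * p + Suc i) mod p = r * p mod p" by simp
      then show False using Suc.prems by simp
    qed
    then show ?case
      using Suc h_step[of "s + j * p + i"] by simp
  qed simp
  \<comment> \<open>By \<open>h_special\<close> the first term of the next section is the last
    difference before it, which \<open>h_regular\<close> carries back to the start of the current
    section.\<close>
  have h_section: "h (s + j * p + p + 1) = h (s + j * p + 1) - h (s + j * p)" for j
    using h_special[of "Suc j"] h_regular[of "p - 1" j] assms by (simp add: algebra_simps)
  show ?thesis
  \<comment> \<open>Taking \<open>d j\<close> to be the first term of section \<open>j + 1\<close>
    makes \<open>a j 1 = d (j - 1)\<close> hold by reflexivity and also fixes \<open>d\<close> when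
    \<open>p = 1\<close>, where a section has no inner differences.\<close>
  proof (intro exI[of _ "\<lambda>j i. h (s + (j - 1) * p + i)"] exI[of _ "\<lambda>j. h (s + j * p + 1)"] conjI)
    show "\<forall>n\<in>{1..s}. hankel n (dyck_gf m V) = 1"
    proof
      fix n assume "n \<in> {1..s}"
      then show "hankel n (dyck_gf m V) = 1"
        using h_init[of "n - 1"] by (cases n) (simp_all add: h_def)
    qed
    show "\<forall>j\<ge>1. \<forall>i\<in>{1..<p}. h (s + (j - 1) * p + (i + 1)) - h (s + (j - 1) * p + i) = h (s + j * p + 1)"
    proof (intro allI impI ballI)
      fix j i :: nat
      assume "1 \<le> j" "i \<in> {1..<p}"
      then show "h (s + (j - 1) * p + (i + 1)) - h (s + (j - 1) * p + i) = h (s + j * p + 1)"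
        using h_regular[of i "j - 1"] h_section[of "j - 1"] by (cases j) (simp_all add: algebra_simps)
    qed
    show "h (s + (1 - 1) * p + 1) = 0"
      using h_special[of 0] h_init[of "s - 1"] assms by simp
    show "h (s + 1 * p + 1) = - 1"
      using h_section[of 0] h_special[of 0] h_init[of "s - 1"] assms by simp
    show "\<forall>j\<ge>2. h (s + (j - 1) * p + 1) = h (s + (j - 1) * p + 1)
        \<and> h (s + j * p + 1) = h (s + (j - 1) * p + 1) - h (s + (j - 1 - 1) * p + p)"
    proof (intro allI impI conjI refl)
      fix j :: nat
      assume "2 \<le> j"
      then obtain k where "j = Suc (Suc k)"
        by (metis add_2_eq_Suc le_Suc_ex)
      then show "h (s + j * p + 1) = h (s + (j - 1) * p + 1) - h (s + (j - 1 - 1) * p + p)"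
        using h_section[of "Suc k"] by (simp add: algebra_simps)
    qed
  qed (simp add: h_def)
qed

end
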